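(* Let $N\ge 1$, let $W$ be an $N\times N$ nonnegative matrix without null rows and without null columns, and let $\mathcal{K}\subseteq\{r,c\}\times\{1,\ldots,N\}$ be such that $W^{(k)}_l=0$ whenever $(k,l)\in\mathcal{K}$. Define the nonnegative $N\times N$ matrix $W^*$ by \[ W^*_{ij}=\begin{cases} W_{ij} & \text{if } (r,i)\in\mathcal{K}\text{ or }(c,j)\in\mathcal{K},\\ 0 & \text{if } (r,i)\notin\mathcal{K}\text{ and }(c,j)\notin\mathcal{K}.\end{cases} \] Then $W^*$ is a convex combination of $\mathcal{K}$-permutation matrices.
   Context: Row and column excesses: $W^{(r)}_i=\sum_j W_{ij}-1$ and $W^{(c)}_j=\sum_i W_{ij}-1$. The symbols $r$ and $c$ are labels for "row" and "column"; thus $(r,l)\in\mathcal{K}$ refers to the $l$-th row and $(c,l)\in\mathcal{K}$ to the $l$-th column. A $\mathcal{K}$-diagonal is a set $D\subseteq\{1,\ldots,N\}^2$ of matrix positions such that for every $(r,l)\in\mathcal{K}$ exactly one element of $D$ lies in the $l$-th row, and for every $(c,l)\in\mathcal{K}$ exactly one element of $D$ lies in the $l$-th column. (No constraint is imposed on rows and columns not in $\mathcal{K}$.) A $\mathcal{K}$-permutation matrix is an $N\times N$ real matrix with entries $1$ on the positions of some $\mathcal{K}$-diagonal and $0$ elsewhere. *)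

theory Defs
  imports "HOL-Analysis.Analysis"
begin

text \<open>
  Matrices of size \<open>N \<times> N\<close> have type \<open>real^'n^'n\<close>, where \<open>N = CARD('n)\<close>, and \<open>W $ i $ j\<close> is the
  entry in row \<open>i\<close> and column \<open>j\<close>. A finite index type \<open>'n\<close> plays the role of \<open>{1, \<dots>, N}\<close>;
  as types are nonempty, \<open>N \<ge> 1\<close> holds automatically. The pair \<open>(Row, l)\<close> stands for the
  \<open>l\<close>-th row and \<open>(Col, l)\<close> for the \<open>l\<close>-th column.
\<close>

datatype line = Row | Col

fun excess :: "real^'n^'n \<Rightarrow> line \<Rightarrow> 'n::finite \<Rightarrow> real" where
  "excess W Row i = (\<Sum>j\<in>UNIV. W $ i $ j) - 1"
| "excess W Col j = (\<Sum>i\<in>UNIV. W $ i $ j) - 1"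

definition nonneg_matrix :: "real^'n^'n::finite \<Rightarrow> bool" where
  "nonneg_matrix W \<longleftrightarrow> (\<forall>i j. 0 \<le> W $ i $ j)"

definition null_row :: "real^'n^'n::finite \<Rightarrow> 'n \<Rightarrow> bool" where
  "null_row W i \<longleftrightarrow> (\<forall>j. W $ i $ j = 0)"

definition null_column :: "real^'n^'n::finite \<Rightarrow> 'n \<Rightarrow> bool" where
  "null_column W j \<longleftrightarrow> (\<forall>i. W $ i $ j = 0)"

definition K_diagonal :: "(line \<times> 'n) set \<Rightarrow> ('n \<times> 'n) set \<Rightarrow> bool" where
  "K_diagonal K D \<longleftrightarrow>
     (\<forall>l. (Row, l) \<in> K \<longrightarrow> (\<exists>!p. p \<in> D \<and> fst p = l)) \<and>
     (\<forall>l. (Col, l) \<in> K \<longrightarrow> (\<exists>!p. p \<in> D \<and> snd p = l))"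

definition K_permutation_matrix :: "(line \<times> 'n) set \<Rightarrow> real^'n^'n::finite \<Rightarrow> bool" where
  "K_permutation_matrix K P \<longleftrightarrow>
     (\<exists>D. K_diagonal K D \<and> P = (\<chi> i j. if (i, j) \<in> D then 1 else 0))"

definition K_restriction :: "(line \<times> 'n) set \<Rightarrow> real^'n^'n \<Rightarrow> real^'n^'n::finite" where
  "K_restriction K W = (\<chi> i j. if (Row, i) \<in> K \<or> (Col, j) \<in> K then W $ i $ j else 0)"

end

theory Submission
  imports Defs
begin

text \<open>
  The proof follows the polyhedral route to Birkhoff's theorem. Consider the polytope of all
  nonnegative matrices that vanish off the lines in \<open>K\<close> and whose entries sum to \<open>1\<close> along every
  line in \<open>K\<close>. The restriction \<open>W\<^sup>*\<close> belongs to it, because a line in \<open>K\<close> loses no entry. Every cell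
  that may be nonzero lies on a line of sum \<open>1\<close>, so the polytope is bounded, and by the
  Krein-Milman theorem it is the convex hull of its extreme points
  (\<open>K_polytope_eq_hull_of_extreme_points\<close>). A 0/1 matrix in the polytope is a
  \<open>K\<close>-permutation matrix, hence it suffices that extreme points have entries in \<open>{0, 1}\<close>.

  Suppose that the set \<open>F\<close> of cells with a fractional entry is nonempty. A line of sum \<open>1\<close> cannot
  contain exactly one fractional entry, so each line of \<open>K\<close> that meets \<open>F\<close> meets it at least
  twice. A cell lies on two lines only; double counting shows that there are at most as many such
  lines as there are cells in \<open>F\<close>. The condition that a matrix supported on \<open>F\<close> has sum \<open>0\<close> along
  these lines is thus a homogeneous linear system with at most as many equations as unknowns. With
  fewer equations it has a nonzero solution for dimension reasons. In the case of equality every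
  cell of \<open>F\<close> lies on two of the lines, and then one equation is redundant, since
  the sum of all row sums is the sum of all column sums; so again there is a nonzero solution \<open>Y\<close>
  (\<open>exists_zero_line_sum_matrix\<close>). Moving by a small multiple of \<open>Y\<close> in both
  directions stays in the polytope, and the point was not extreme.
\<close>

section \<open>Cells and lines\<close>

abbreviation entry :: "real^'n^'n::finite \<Rightarrow> 'n \<times> 'n \<Rightarrow> real" where
  "entry X p \<equiv> X $ fst p $ snd p"

fun line_cells :: "line \<times> 'n \<Rightarrow> ('n \<times> 'n) set" where
  "line_cells (Row, i) = {p. fst p = i}"
| "line_cells (Col, j) = {p. snd p = j}"

lemma sum_row_cells:
  fixes f :: "'n \<times> 'n::finite \<Rightarrow> real"
  shows "(\<Sum>p\<in>line_cells (Row, i). f p) = (\<Sum>j\<in>UNIV. f (i, j))"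
  by (rule sum.reindex_bij_witness[of _ "\<lambda>j. (i, j)" snd]) auto

lemma sum_column_cells:
  fixes f :: "'n \<times> 'n::finite \<Rightarrow> real"
  shows "(\<Sum>p\<in>line_cells (Col, j). f p) = (\<Sum>i\<in>UNIV. f (i, j))"
  by (rule sum.reindex_bij_witness[of _ "\<lambda>i. (i, j)" fst]) auto

lemma excess_eq_sum_line_cells:
  "excess X k l = (\<Sum>p\<in>line_cells (k, l). entry X p) - 1"
  by (cases k) (simp_all only: excess.simps sum_row_cells sum_column_cells fst_conv snd_conv)

lemma K_diagonal_iff_line_cells:
  "K_diagonal K D \<longleftrightarrow> (\<forall>q\<in>K. \<exists>!p. p \<in> D \<inter> line_cells q)"
proof -
  have "(\<forall>k. P k) \<longleftrightarrow> P Row \<and> P Col" for P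
    by (metis (full_types) line.exhaust)
  then show ?thesis
    by (simp only: K_diagonal_def Ball_def split_paired_All line_cells.simps Int_iff mem_Collect_eq)
qed

lemma lines_through_cell: "{q. p \<in> line_cells q} = {(Row, fst p), (Col, snd p)}"
proof -
  have "p \<in> line_cells q \<longleftrightarrow> q = (Row, fst p) \<or> q = (Col, snd p)" for q
    by (cases q rule: line_cells.cases) auto
  then show ?thesis by auto
qed

lemma finite_line_set: "finite (L :: (line \<times> 'n::finite) set)"
proof (rule finite_subset)
  have "k \<in> {Row, Col}" for k
    by (cases k) auto
  then show "L \<subseteq> {Row, Col} \<times> UNIV"
    by auto
qed simp

lemma sum_rows_eq_sum_columns:
  fixes Y :: "real^'n^'n::finite"
  shows "(\<Sum>i\<in>UNIV. \<Sum>p\<in>line_cells (Row, i). entry Y p)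
       = (\<Sum>j\<in>UNIV. \<Sum>p\<in>line_cells (Col, j). entry Y p)"
  by (simp only: sum_row_cells sum_column_cells fst_conv snd_conv) (rule sum.swap)

section \<open>Matrices with prescribed support and zero line sums\<close>

text \<open>
  The equations say that \<open>Y\<close> is orthogonal to the indicator matrices of the sets \<open>A q \<inter> F\<close>.
  These span a subspace of dimension at most \<open>card L\<close> inside the space of matrices supported on
  \<open>F\<close>, whose dimension is \<open>card F\<close>.
\<close>

lemma underdetermined_system_has_solution:
  fixes F :: "('n \<times> 'n::finite) set" and A :: "'a \<Rightarrow> ('n \<times> 'n) set"
  assumes "finite L" and less: "card L < card F"
  obtains Y :: "real^'n^'n" where "Y \<noteq> 0" and "\<And>p. p \<notin> F \<Longrightarrow> entry Y p = 0"
    and "\<And>q. q \<in> L \<Longrightarrow> (\<Sum>p\<in>A q. entry Y p) = 0"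
proof -
  define unit :: "'n \<times> 'n \<Rightarrow> real^'n^'n" where "unit p = axis (fst p) (axis (snd p) 1)" for p
  define ind :: "'a \<Rightarrow> real^'n^'n" where "ind q = (\<Sum>p\<in>A q \<inter> F. unit p)" for q
  have unit_inner: "unit p \<bullet> Y = entry Y p" for p Y
    by (simp add: unit_def inner_axis')
  have entry_unit: "entry (unit p) p' = (if p' = p then 1 else 0)" for p p'
    by (auto simp: unit_def axis_def prod_eq_iff)
  have inj: "inj_on unit F"
    by (metis entry_unit inj_onI zero_neq_one)
  have unit_Basis: "unit ` F \<subseteq> Basis"
    by (auto simp: unit_def Basis_vec_def)
  have dim_unit: "dim (span (unit ` F)) = card F"
  proof -
    have "independent (unit ` F)"
      using independent_Basis unit_Basis independent_mono by blast
    then show ?thesis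
      using dim_span dim_eq_card_independent card_image[OF inj] by metis
  qed
  have "ind q \<in> span (unit ` F)" for q
    unfolding ind_def by (intro span_sum span_base) simp
  then have sub: "span (ind ` L) \<subseteq> span (unit ` F)"
    by (intro span_minimal) auto
  have "dim (span (ind ` L)) \<le> card L"
    using dim_le_card[of "span (ind ` L)" "ind ` L"] card_image_le[OF \<open>finite L\<close>, of ind] \<open>finite L\<close>
    by simp
  then have "span (ind ` L) \<noteq> span (unit ` F)"
    using less dim_unit by (metis leD)
  then have "span (ind ` L) \<subset> span (unit ` F)"
    using sub by blast
  then obtain Y where Y: "Y \<noteq> 0" "Y \<in> span (unit ` F)"
    and orth: "\<And>y. y \<in> span (ind ` L) \<Longrightarrow> orthogonal Y y"
    by (rule orthogonal_to_subspace_exists_gen) blast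
  have supp: "entry Y p = 0" if "p \<notin> F" for p
  proof -
    have "subspace {Z :: real^'n^'n. entry Z p = 0}"
      by (simp add: subspace_def)
    moreover have "unit ` F \<subseteq> {Z. entry Z p = 0}"
      using that by (auto simp: entry_unit)
    ultimately show ?thesis
      using Y(2) span_minimal by blast
  qed
  have "(\<Sum>p\<in>A q. entry Y p) = 0" if "q \<in> L" for q
  proof -
    have "(\<Sum>p\<in>A q. entry Y p) = (\<Sum>p\<in>A q \<inter> F. entry Y p)"
      by (rule sum.mono_neutral_right) (auto simp: supp)
    also have "\<dots> = ind q \<bullet> Y"
      by (simp add: ind_def inner_sum_left unit_inner)
    also have "\<dots> = 0"
      using orth[of "ind q"] that by (simp add: span_base orthogonal_def inner_commute)
    finally show ?thesis .
  qed
  then show thesis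
    using that Y(1) supp by blast
qed

text \<open>
  Count incidences between the cells of \<open>F\<close> and the lines of \<open>L\<close>: there are at least
  \<open>2 * card L\<close> of them, and at most two for each cell. Equality forces two for each cell.
\<close>

lemma card_lines_le_card_cells:
  fixes F :: "('n \<times> 'n::finite) set" and L :: "(line \<times> 'n) set"
  assumes two: "\<And>q. q \<in> L \<Longrightarrow> 2 \<le> card (F \<inter> line_cells q)"
  shows "card L \<le> card F"
    and "\<lbrakk>card L = card F; p \<in> F\<rbrakk> \<Longrightarrow> {q. p \<in> line_cells q} \<subseteq> L"
proof -
  let ?through = "\<lambda>p. {q. p \<in> line_cells q}"
  have card_through: "card (?through p) = 2" for p :: "'n \<times> 'n"
    by (simp add: lines_through_cell)
  have le2: "card (L \<inter> ?through p) \<le> 2" for p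
    using card_mono[OF finite_line_set, of "L \<inter> ?through p" "?through p"] card_through[of p] by simp
  have "2 * card L \<le> (\<Sum>q\<in>L. card (F \<inter> line_cells q))"
    using sum_mono[OF two, of L "\<lambda>q. q"] by simp
  also have "\<dots> = (\<Sum>q\<in>L. \<Sum>p\<in>F. of_bool (p \<in> line_cells q))"
    by (simp add: Int_def)
  also have "\<dots> = (\<Sum>p\<in>F. \<Sum>q\<in>L. of_bool (p \<in> line_cells q))"
    by (rule sum.swap)
  also have "\<dots> = (\<Sum>p\<in>F. card (L \<inter> ?through p))"
    by (simp add: Int_def finite_line_set)
  finally have count: "2 * card L \<le> (\<Sum>p\<in>F. card (L \<inter> ?through p))" .
  also have "\<dots> \<le> (\<Sum>p\<in>F. 2)"
    by (rule sum_mono) (rule le2)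
  finally show "card L \<le> card F"
    by simp
  assume eq: "card L = card F" and p: "p \<in> F"
  have "card (L \<inter> ?through p) = 2"
  proof (rule ccontr)
    assume "card (L \<inter> ?through p) \<noteq> 2"
    then have "card (L \<inter> ?through p) < 2"
      using le2[of p] by simp
    then have "(\<Sum>p\<in>F. card (L \<inter> ?through p)) < (\<Sum>p\<in>F. 2)"
      using le2 p by (intro sum_strict_mono_ex1) auto
    then show False
      using count eq by simp
  qed
  then have "L \<inter> ?through p = ?through p"
    using card_subset_eq[OF finite_line_set, of "L \<inter> ?through p" "?through p"] card_through[of p]
    by simp
  then show "?through p \<subseteq> L"
    by blast
qed

text \<open>
  Row sums and column sums have the same total, so a single line sum is \<open>0\<close> as soon as
  all others are.
\<close>

lemma remaining_line_sum_zero: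
  fixes Y :: "real^'n^'n::finite"
  assumes zero: "\<And>q. q \<noteq> q0 \<Longrightarrow> (\<Sum>p\<in>line_cells q. entry Y p) = 0"
  shows "(\<Sum>p\<in>line_cells q. entry Y p) = 0"
proof (cases "q = q0")
  case True
  define s where "s k l = (\<Sum>p\<in>line_cells (k, l). entry Y p)" for k l
  have total: "(\<Sum>i\<in>UNIV. s Row i) = (\<Sum>j\<in>UNIV. s Col j)"
    unfolding s_def by (rule sum_rows_eq_sum_columns)
  obtain k l where q0: "q0 = (k, l)"
    by fastforce
  have off: "s k' l' = 0" if "(k', l') \<noteq> (k, l)" for k' l'
    unfolding s_def using zero[of "(k', l')"] that q0 by simp
  have single: "(\<Sum>l'\<in>UNIV. s k l') = s k l"
    using sum.mono_neutral_right[of UNIV "{l}" "s k"] off by simp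
  have "s k l = 0"
  proof (cases k)
    case Row
    have "(\<Sum>j\<in>UNIV. s Col j) = 0"
      by (rule sum.neutral) (simp add: off Row)
    then show ?thesis
      using total single Row by simp
  next
    case Col
    have "(\<Sum>i\<in>UNIV. s Row i) = 0"
      by (rule sum.neutral) (simp add: off Col)
    then show ?thesis
      using total single Col by simp
  qed
  then show ?thesis
    by (simp add: s_def True q0)
qed (rule zero)

text \<open>
  For \<open>card L = card F\<close> the system is square, and the equation of an arbitrary line \<open>q0\<close> is dropped.
  This is harmless: no cell of \<open>F\<close> lies on a line outside \<open>L\<close> in this case, so the matrix has sum
  \<open>0\<close> along every line but \<open>q0\<close>, and hence along \<open>q0\<close> as well.
\<close>

lemma exists_zero_line_sum_matrix:
  fixes F :: "('n \<times> 'n::finite) set" and L :: "(line \<times> 'n) set"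
  assumes nonempty: "F \<noteq> {}"
    and two: "\<And>q. q \<in> L \<Longrightarrow> 2 \<le> card (F \<inter> line_cells q)"
  obtains Y :: "real^'n^'n" where "Y \<noteq> 0" and "\<And>p. p \<notin> F \<Longrightarrow> entry Y p = 0"
    and "\<And>q. q \<in> L \<Longrightarrow> (\<Sum>p\<in>line_cells q. entry Y p) = 0"
proof (cases "card L = card F")
  case False
  then have "card L < card F"
    using card_lines_le_card_cells(1)[OF two] by fastforce
  from underdetermined_system_has_solution[OF finite_line_set this] that show thesis
    by blast
next
  case True
  have "card F \<noteq> 0"
    using nonempty by simp
  then obtain q0 where q0: "q0 \<in> L"
    by (metis True card.empty ex_in_conv)
  have "card (L - {q0}) < card F"
    using True q0 card_Diff1_less[OF finite_line_set q0] by simp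
  then obtain Y :: "real^'n^'n" where Y: "Y \<noteq> 0" and supp: "\<And>p. p \<notin> F \<Longrightarrow> entry Y p = 0"
    and sums: "\<And>q. q \<in> L - {q0} \<Longrightarrow> (\<Sum>p\<in>line_cells q. entry Y p) = 0"
    by (rule underdetermined_system_has_solution[OF finite_line_set]) (rule that)
  have "(\<Sum>p\<in>line_cells q. entry Y p) = 0" if "q \<noteq> q0" for q
  proof (cases "q \<in> L")
    case False
    have "p \<notin> F" if "p \<in> line_cells q" for p
      using card_lines_le_card_cells(2)[OF two True, of p] that False by blast
    then show ?thesis
      by (intro sum.neutral) (simp add: supp)
  qed (use sums that in simp)
  then have "(\<Sum>p\<in>line_cells q. entry Y p) = 0" for q
    by (rule remaining_line_sum_zero)
  then show thesis
    using that Y supp by blast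
qed

section \<open>The polytope of matrices with unit sums along the lines in K\<close>

definition K_polytope :: "(line \<times> 'n) set \<Rightarrow> (real^'n^'n::finite) set" where
  "K_polytope K = {X. (\<forall>p. 0 \<le> entry X p) \<and>
     (\<forall>p. {q. p \<in> line_cells q} \<inter> K = {} \<longrightarrow> entry X p = 0) \<and>
     (\<forall>q\<in>K. (\<Sum>p\<in>line_cells q. entry X p) = 1)}"

lemma K_polytope_entry_le_1:
  assumes "X \<in> K_polytope K"
  shows "entry X p \<le> 1"
proof (cases "{q. p \<in> line_cells q} \<inter> K = {}")
  case True
  then show ?thesis
    using assms by (simp add: K_polytope_def)
next
  case False
  then obtain q where "q \<in> K" "p \<in> line_cells q"
    by blast
  then show ?thesis
    using assms member_le_sum[of p "line_cells q" "entry X"] by (simp add: K_polytope_def)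
qed

lemma compact_K_polytope: "compact (K_polytope K)"
proof -
  have "bounded (K_polytope K)"
    unfolding bounded_iff
  proof (intro exI ballI)
    fix X assume X: "X \<in> K_polytope K"
    have "\<bar>X $ i $ j\<bar> \<le> 1" for i j
      using K_polytope_entry_le_1[OF X, of "(i, j)"] X by (auto simp: K_polytope_def)
    then have "norm (X $ i) \<le> (\<Sum>j\<in>(UNIV::'a set). 1)" for i
      using norm_le_l1_cart[of "X $ i"] by (meson order_trans sum_mono)
    then show "norm X \<le> (\<Sum>i\<in>(UNIV::'a set). \<Sum>j\<in>(UNIV::'a set). 1)"
      using L2_set_le_sum[of UNIV "\<lambda>i. norm (X $ i)"]
      by (subst norm_vec_def) (meson norm_ge_zero order_trans sum_mono)
  qed
  moreover have "closed (K_polytope K)"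
    unfolding K_polytope_def Ball_def
    by (intro closed_Collect_conj closed_Collect_all closed_Collect_imp closed_Collect_le
        closed_Collect_eq open_Collect_const continuous_intros)
  ultimately show ?thesis
    by (simp add: compact_eq_bounded_closed)
qed

lemma convex_K_polytope: "convex (K_polytope K)"
proof (rule convexI)
  fix X Y :: "real^'a^'a" and u v :: real
  assume XY: "X \<in> K_polytope K" "Y \<in> K_polytope K" and uv: "0 \<le> u" "0 \<le> v" "u + v = 1"
  have "(\<Sum>p\<in>line_cells q. entry (u *\<^sub>R X + v *\<^sub>R Y) p)
      = u * (\<Sum>p\<in>line_cells q. entry X p) + v * (\<Sum>p\<in>line_cells q. entry Y p)" for q
    by (simp add: sum.distrib sum_distrib_left)
  then show "u *\<^sub>R X + v *\<^sub>R Y \<in> K_polytope K"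
    using XY uv by (simp add: K_polytope_def)
qed

lemma K_polytope_eq_hull_of_extreme_points:
  "K_polytope K = convex hull {X. X extreme_point_of K_polytope K}"
  by (rule Krein_Milman_Minkowski[OF compact_K_polytope convex_K_polytope])

section \<open>Extreme points are 0/1 matrices\<close>

text \<open>
  If a line of sum \<open>1\<close> contained a single fractional entry, that entry would be the difference of
  two integers.
\<close>

lemma two_fractional_cells:
  assumes "finite A" and sum1: "(\<Sum>p\<in>A. f p) = (1::real)"
    and p: "p \<in> A" "f p \<notin> \<int>"
  shows "2 \<le> card ({p. f p \<notin> \<int>} \<inter> A)"
proof (rule ccontr)
  let ?B = "{p. f p \<notin> \<int>} \<inter> A"
  assume "\<not> 2 \<le> card ?B"
  moreover have "p \<in> ?B" "finite ?B"
    using assms by auto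
  ultimately have B: "?B = {p}"
    by (metis One_nat_def Suc_1 card_1_singletonE card_gt_0_iff empty_iff le_antisym
        not_less_eq_eq singletonD Suc_leI)
  have "(\<Sum>x\<in>A - {p}. f x) \<in> \<int>"
    by (rule Ints_sum) (use B in blast)
  moreover have "f p = 1 - (\<Sum>x\<in>A - {p}. f x)"
    using sum.remove[OF \<open>finite A\<close> p(1), of f] sum1 by simp
  ultimately show False
    using p(2) by simp
qed

text \<open>
  Otherwise \<open>X\<close> is the midpoint of two other points of the polytope. The direction \<open>Y\<close> is
  supported on the fractional cells, where \<open>X\<close> is bounded away from \<open>0\<close>, so a small step keeps the
  entries nonnegative. The lines of \<open>K\<close> that miss these cells impose no condition on \<open>Y\<close>.
\<close>

lemma extreme_point_of_K_polytope_integral: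
  fixes X :: "real^'n^'n::finite"
  assumes ext: "X extreme_point_of K_polytope K"
  shows "entry X p \<in> {0, 1}"
proof -
  have X: "X \<in> K_polytope K"
    using ext by (simp add: extreme_point_of_def)
  have ge0: "0 \<le> entry X p" for p
    using X by (simp add: K_polytope_def)
  define F where "F = {p. entry X p \<notin> \<int>}"
  define L where "L = {q \<in> K. F \<inter> line_cells q \<noteq> {}}"
  have "F = {}"
  proof (rule ccontr)
    assume "F \<noteq> {}"
    have two: "2 \<le> card (F \<inter> line_cells q)" if q: "q \<in> L" for q
    proof -
      obtain p where p: "p \<in> line_cells q" "entry X p \<notin> \<int>"
        using q by (auto simp: L_def F_def)
      have "(\<Sum>p\<in>line_cells q. entry X p) = 1"
        using q X by (simp add: L_def K_polytope_def)
      then show ?thesis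
        using two_fractional_cells[where f = "entry X", OF _ _ p] by (simp add: F_def)
    qed
    obtain Y :: "real^'n^'n" where Y: "Y \<noteq> 0" and supp: "\<And>p. p \<notin> F \<Longrightarrow> entry Y p = 0"
      and sumsL: "\<And>q. q \<in> L \<Longrightarrow> (\<Sum>p\<in>line_cells q. entry Y p) = 0"
      by (rule exists_zero_line_sum_matrix[of F L, OF \<open>F \<noteq> {}\<close> two]) (assumption, rule that)
    have sums: "(\<Sum>p\<in>line_cells q. entry Y p) = 0" if "q \<in> K" for q
    proof (cases "q \<in> L")
      case False
      then show ?thesis
        using that by (intro sum.neutral) (auto simp: L_def intro!: supp)
    qed (rule sumsL)
    define m where "m = Min (entry X ` F)"
    have "m \<in> entry X ` F"
      unfolding m_def using \<open>F \<noteq> {}\<close> by (intro Min_in) auto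
    then have "m > 0"
      using ge0 by (auto simp: F_def less_le)
    have m_le: "m \<le> entry X p" if "p \<in> F" for p
      unfolding m_def using that by simp
    define e where "e = m / norm Y"
    have "e > 0"
      using \<open>m > 0\<close> Y by (simp add: e_def)
    \<comment> \<open>No entry of \<open>Y\<close> exceeds \<open>norm Y\<close>, so a step of length \<open>e\<close> changes an entry by at most \<open>m\<close>.\<close>
    have small: "\<bar>e * entry Y p\<bar> \<le> entry X p" for p
    proof (cases "p \<in> F")
      case True
      have "\<bar>entry Y p\<bar> \<le> norm Y"
        using component_le_norm_cart[of "Y $ fst p" "snd p"]
          Finite_Cartesian_Product.norm_nth_le[of Y "fst p"] by linarith
      then have "e * \<bar>entry Y p\<bar> \<le> e * norm Y"
        using \<open>e > 0\<close> by simp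
      also have "\<dots> = m"
        using Y by (simp add: e_def)
      finally show ?thesis
        using m_le[OF True] \<open>e > 0\<close> by (simp add: abs_mult)
    qed (simp add: supp ge0)
    have step: "X + c *\<^sub>R Y \<in> K_polytope K" if c: "\<bar>c\<bar> = e" for c
    proof -
      have "0 \<le> entry X p + c * entry Y p" for p
        using small[of p] c \<open>e > 0\<close> by (auto simp: abs_mult abs_if split: if_splits)
      moreover have "p \<notin> F" if "{q. p \<in> line_cells q} \<inter> K = {}" for p
        using X that by (simp add: F_def K_polytope_def)
      ultimately show ?thesis
        using X sums supp unfolding K_polytope_def
        by (intro CollectI conjI allI impI ballI)
          (simp_all add: sum.distrib sum_distrib_left[symmetric])
    qed
    have "X + e *\<^sub>R Y \<in> K_polytope K" "X + (- e) *\<^sub>R Y \<in> K_polytope K"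
      using \<open>e > 0\<close> by (auto intro!: step simp del: scaleR_minus_left add_uminus_conv_diff)
    moreover have "X \<in> open_segment (X + e *\<^sub>R Y) (X + (- e) *\<^sub>R Y)"
    proof -
      have "e *\<^sub>R Y \<noteq> (- e) *\<^sub>R Y"
        using Y \<open>e > 0\<close> by (simp only: scaleR_cancel_right) simp
      then have "X + e *\<^sub>R Y \<noteq> X + (- e) *\<^sub>R Y"
        by (simp only: add_left_cancel not_False_eq_True)
      moreover have "X = midpoint (X + e *\<^sub>R Y) (X + (- e) *\<^sub>R Y)"
        by (simp add: midpoint_def scaleR_2[symmetric])
      ultimately show ?thesis
        by (metis midpoint_in_open_segment)
    qed
    ultimately show False
      using ext by (auto simp: extreme_point_of_def)
  qed
  then have "entry X p \<in> \<int>"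
    unfolding F_def by blast
  then obtain z where "entry X p = of_int z"
    by (rule Ints_cases)
  with ge0[of p] K_polytope_entry_le_1[OF X, of p] show ?thesis
    by (cases "z = 0") auto
qed

section \<open>Convex decomposition\<close>

lemma integral_K_polytope_K_permutation_matrix:
  fixes X :: "real^'n^'n::finite"
  assumes X: "X \<in> K_polytope K" and int: "\<And>p. entry X p \<in> {0, 1}"
  shows "K_permutation_matrix K X"
proof -
  define D where "D = {p. entry X p = 1}"
  have entry: "entry X p = of_bool (p \<in> D)" for p
    using int[of p] by (auto simp: D_def)
  have "\<exists>!p. p \<in> D \<inter> line_cells q" if "q \<in> K" for q
  proof -
    have "(\<Sum>p\<in>line_cells q. of_bool (p \<in> D)) = (1::real)"
      using X that by (simp add: K_polytope_def entry)
    then have "card (D \<inter> line_cells q) = 1"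
      by (simp add: Int_commute)
    then show ?thesis
      by (metis card_1_singletonE singleton_iff)
  qed
  then have "K_diagonal K D"
    by (simp add: K_diagonal_iff_line_cells)
  moreover have "X = (\<chi> i j. if (i, j) \<in> D then 1 else 0)"
    using entry[of "(_, _)"] by (simp add: vec_eq_iff)
  ultimately show ?thesis
    unfolding K_permutation_matrix_def by blast
qed

lemma K_restriction_in_K_polytope:
  fixes W :: "real^'n^'n::finite"
  assumes "nonneg_matrix W" and exc: "\<forall>k l. (k, l) \<in> K \<longrightarrow> excess W k l = 0"
  shows "K_restriction K W \<in> K_polytope K"
proof -
  have entry: "entry (K_restriction K W) p = (if {q. p \<in> line_cells q} \<inter> K = {} then 0 else entry W p)"
    for p
    by (simp add: K_restriction_def lines_through_cell)
  have "(\<Sum>p\<in>line_cells q. entry (K_restriction K W) p) = 1" if q: "q \<in> K" for q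
  proof -
    have "(\<Sum>p\<in>line_cells q. entry (K_restriction K W) p) = (\<Sum>p\<in>line_cells q. entry W p)"
      by (rule sum.cong) (use q in \<open>auto simp: entry\<close>)
    also have "\<dots> = 1"
      using exc q excess_eq_sum_line_cells[of W "fst q" "snd q"] by simp
    finally show ?thesis .
  qed
  moreover have "0 \<le> entry (K_restriction K W) p" for p
    using assms(1) unfolding entry by (simp add: nonneg_matrix_def)
  moreover have "entry (K_restriction K W) p = 0" if "{q. p \<in> line_cells q} \<inter> K = {}" for p
    unfolding entry using that by simp
  ultimately show ?thesis
    unfolding K_polytope_def by blast
qed

theorem theorem3p3:
  fixes W :: "real^'n^'n::finite" and K :: "(line \<times> 'n) set"
  assumes "nonneg_matrix W"
    and "\<forall>i. \<not> null_row W i"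
    and "\<forall>j. \<not> null_column W j"
    and "\<forall>k l. (k, l) \<in> K \<longrightarrow> excess W k l = 0"
  shows "K_restriction K W \<in> convex hull {P. K_permutation_matrix K P}"
proof -
  have "{X. X extreme_point_of K_polytope K} \<subseteq> {P. K_permutation_matrix K P}"
  proof (clarify)
    fix X assume X: "X extreme_point_of K_polytope K"
    then have "X \<in> K_polytope K"
      by (simp add: extreme_point_of_def)
    then show "K_permutation_matrix K X"
      using extreme_point_of_K_polytope_integral[OF X]
      by (rule integral_K_polytope_K_permutation_matrix)
  qed
  then have "K_polytope K \<subseteq> convex hull {P. K_permutation_matrix K P}"
    by (subst K_polytope_eq_hull_of_extreme_points) (rule hull_mono)
  then show ?thesis
    using K_restriction_in_K_polytope[OF assms(1,4)] by blast
qed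

end
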